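(* Let $m,n\ge 1$ and let $$a(\lambda)=a_0\lambda^m+a_1\lambda^{m-1}+\dots+a_m=a_0(\lambda-\alpha_1)\cdots(\lambda-\alpha_m),$$ $$b(\lambda)=b_0\lambda^n+b_1\lambda^{n-1}+\dots+b_n=b_0(\lambda-\beta_1)\cdots(\lambda-\beta_n)$$ be complex polynomials with $a_0b_0\neq 0$, where $\alpha_1,\dots,\alpha_m$ are pairwise different and $\beta_1,\dots,\beta_n$ are pairwise different. Let $S(a,b)$ be their $(m+n)\times(m+n)$ Sylvester matrix. If $\det S(a,b)\ne 0$, then $$S(a,b)^{-1}=\sum_{i=1}^m \Lambda(\alpha_i)\,\frac{1}{b(\alpha_i)\left(\left.\frac{a(\lambda)}{\lambda-\alpha_i}\right|_{\lambda=\alpha_i}\right)}\Big[\underbrace{0,\dots,0}_{n},\ \mathrm{row}_m\Big(\frac{a(\lambda)}{\lambda-\alpha_i}\Big)\Big]$$ $$\qquad+\sum_{j=1}^n \Lambda(\beta_j)\,\frac{1}{a(\beta_j)\left(\left.\frac{b(\lambda)}{\lambda-\beta_j}\right|_{\lambda=\beta_j}\right)}\Big[\mathrm{row}_n\Big(\frac{b(\lambda)}{\lambda-\beta_j}\Big),\ \underbrace{0,\dots,0}_{m}\Big],$$ and, for every complex polynomial $c(\lambda)$ of degree at most $m+n-1$, the solution of the equation $a(\lambda)x(\lambda)+b(\lambda)y(\lambda)=c(\lambda)$ in polynomials $x$ of degree at most $n-1$ and $y$ of degree at most $m-1$ is given by $$x(\lambda)=\sum_{j=1}^n \frac{\frac{b(\lambda)}{\lambda-\beta_j}}{\left.\frac{b(\lambda)}{\lambda-\beta_j}\right|_{\lambda=\beta_j}}\cdot\frac{c(\beta_j)}{a(\beta_j)},\qquad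 y(\lambda)=\sum_{i=1}^m \frac{\frac{a(\lambda)}{\lambda-\alpha_i}}{\left.\frac{a(\lambda)}{\lambda-\alpha_i}\right|_{\lambda=\alpha_i}}\cdot\frac{c(\alpha_i)}{b(\alpha_i)},$$ i.e., $x(\lambda)$ is the Lagrange interpolation polynomial for the function $c(\lambda)/a(\lambda)$ over the set of zeros of $b(\lambda)$, and $y(\lambda)$ is the one for the function $c(\lambda)/b(\lambda)$ over the set of zeros of $a(\lambda)$.
   Context: Sylvester matrix: $S(a,b)$ is the $(m+n)\times(m+n)$ matrix whose first $n$ rows are the successive right shifts of $[a_0,a_1,\dots,a_m,0,\dots,0]$ (row $p$, $1\le p\le n$, has $p-1$ zeros, then $a_0,\dots,a_m$, then $n-p$ zeros), and whose last $m$ rows are the successive right shifts of $[b_0,b_1,\dots,b_n,0,\dots,0]$ (row $n+p$, $1\le p\le m$, has $p-1$ zeros, then $b_0,\dots,b_n$, then $m-p$ zeros). $\Lambda(\lambda)$ denotes the column of height $m+n$ with entries $\lambda^{m+n-1},\lambda^{m+n-2},\dots,\lambda,1$ from top to bottom. For a polynomial $p(\lambda)=p_0\lambda^{k-1}+p_1\lambda^{k-2}+\dots+p_{k-1}$, $\mathrm{row}_k(p(\lambda))$ denotes the row $[p_0,p_1,\dots,p_{k-1}]$. When $\alpha$ is a zero of $a$, $\frac{a(\lambda)}{\lambda-\alpha}$ denotes the polynomial quotient and $\left.\frac{a(\lambda)}{\lambda-\alpha}\right|_{\lambda=\alpha}$ its value at $\alpha$; similarly for $b$. *)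

theory Defs
  imports
    "Jordan_Normal_Form.Gauss_Jordan_Elimination"
    "Jordan_Normal_Form.Determinant"
    "Subresultants.Resultant_Prelim"
    Complex_Main
begin

text \<open>
  Matrices and vectors of the library are indexed from 0, so that the power in position \<open>i\<close> of the
  column \<open>\<Lambda>(x)\<close> of height \<open>N\<close>, and the coefficient in position \<open>j\<close> of the row of length \<open>k\<close>, are
  those of degree \<open>N - 1 - i\<close> and \<open>k - 1 - j\<close>. The library's \<^const>\<open>sylvester_mat\<close> \<open>a b\<close> has the
  shifts of \<open>a\<close> on top and lists coefficients from the highest degree down, that is, it is \<open>S(a,b)\<close>
  (see \<open>sylvester_mat_entry\<close> below).
\<close>

definition Lambda_col :: "nat \<Rightarrow> complex \<Rightarrow> complex mat" where
  "Lambda_col N x = mat N 1 (\<lambda>(i, _). x ^ (N - 1 - i))"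

definition row_poly :: "nat \<Rightarrow> complex poly \<Rightarrow> complex vec" where
  "row_poly k p = vec k (\<lambda>j. coeff p (k - 1 - j))"

definition lagrange_interpolant :: "complex set \<Rightarrow> (complex \<Rightarrow> complex) \<Rightarrow> complex poly" where
  "lagrange_interpolant Z f =
     (\<Sum>z\<in>Z. smult (f z) (\<Prod>w\<in>Z - {z}. smult (1 / (z - w)) [:- w, 1:]))"

lemma poly_lagrange_interpolant:
  assumes "finite Z" and "z \<in> Z"
  shows "poly (lagrange_interpolant Z f) z = f z"
proof -
  have "poly (lagrange_interpolant Z f) z =
      (\<Sum>u\<in>Z. f u * (\<Prod>w\<in>Z - {u}. (z - w) / (u - w)))"
    by (simp add: lagrange_interpolant_def poly_sum poly_prod diff_divide_distrib)
  also have "\<dots> = (\<Sum>u\<in>Z. if u = z then f z else 0)"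
  proof (rule sum.cong[OF refl])
    fix u assume "u \<in> Z"
    show "f u * (\<Prod>w\<in>Z - {u}. (z - w) / (u - w)) = (if u = z then f z else 0)"
    proof (cases "u = z")
      case True
      have "(\<Prod>w\<in>Z - {z}. (z - w) / (z - w)) = 1"
        by (rule prod.neutral) auto
      with True show ?thesis by simp
    next
      case False
      have "(\<Prod>w\<in>Z - {u}. (z - w) / (u - w)) = 0"
        using assms False by (intro prod_zero) auto
      with False show ?thesis by simp
    qed
  qed
  finally show ?thesis using assms by simp
qed

lemma degree_lagrange_interpolant:
  assumes "finite Z"
  shows "degree (lagrange_interpolant Z f) \<le> card Z - 1"
  unfolding lagrange_interpolant_def
proof (rule degree_sum_le[OF assms])
  fix z assume z: "z \<in> Z"
  have "degree (\<Prod>w\<in>Z - {z}. smult (1 / (z - w)) [:- w, 1:])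
      \<le> (\<Sum>w\<in>Z - {z}. degree (smult (1 / (z - w)) [:- w, 1:]))"
    using degree_prod_sum_le[of "Z - {z}" "\<lambda>w. smult (1 / (z - w)) [:- w, 1:]"] assms
    by (simp add: o_def)
  also have "\<dots> \<le> (\<Sum>w\<in>Z - {z}. 1)"
    by (intro sum_mono order_trans[OF degree_smult_le]) simp
  also have "\<dots> = card Z - 1"
    using assms z by simp
  finally show "degree (smult (f z) (\<Prod>w\<in>Z - {z}. smult (1 / (z - w)) [:- w, 1:])) \<le> card Z - 1"
    by (rule order_trans[OF degree_smult_le])
qed

lemma sylvester_mat_entry:
  fixes ac bc :: "nat \<Rightarrow> complex"
  assumes a: "a = (\<Sum>k\<le>m. monom (ac k) (m - k))" and b: "b = (\<Sum>k\<le>n. monom (bc k) (n - k))"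
    and nz: "ac 0 \<noteq> 0" "bc 0 \<noteq> 0" and ij: "i < m + n" "j < m + n"
  shows "sylvester_mat a b $$ (i, j) =
    (if i < n then (if i \<le> j \<and> j \<le> i + m then ac (j - i) else 0)
     else (if i - n \<le> j \<and> j \<le> i then bc (j - (i - n)) else 0))"
proof -
  have c: "coeff (\<Sum>k\<le>N. monom (g k) (N - k)) t = (if t \<le> N then g (N - t) else 0)"
    for g :: "nat \<Rightarrow> complex" and N t
  proof -
    have "coeff (\<Sum>k\<le>N. monom (g k) (N - k)) t =
        (\<Sum>k\<le>N. if k = N - t then (if t \<le> N then g k else 0) else 0)"
      unfolding coeff_sum by (rule sum.cong) (auto simp: coeff_monom)
    then show ?thesis by simp
  qed
  have d: "degree (\<Sum>k\<le>N. monom (g k) (N - k)) = N" if "g 0 \<noteq> 0"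
    for g :: "nat \<Rightarrow> complex" and N
  proof (rule antisym)
    show "degree (\<Sum>k\<le>N. monom (g k) (N - k)) \<le> N"
      by (rule degree_le) (simp add: c)
    show "N \<le> degree (\<Sum>k\<le>N. monom (g k) (N - k))"
      by (rule le_degree) (simp add: c that)
  qed
  have da: "degree a = m" and db: "degree b = n"
    using d nz by (auto simp: a b)
  show ?thesis
    using ij by (subst sylvester_index_mat) (auto simp: da db, auto simp: a b c intro!: arg_cong[of _ _ ac] arg_cong[of _ _ bc])
qed

end

theory Submission
  imports Defs
begin

text \<open>
  Since \<open>S(a,b) \<Lambda>(z)\<close> lists the values at \<open>z\<close> of the shifts of \<open>a\<close> and \<open>b\<close>, a common zero of \<open>a\<close>
  and \<open>b\<close> would give a kernel vector. The product of \<open>S(a,b)\<close> with the claimed inverse is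
  block diagonal, because \<open>\<Lambda>(\<alpha>\<^sub>i)\<close> only sees the rows of \<open>b\<close> and \<open>\<Lambda>(\<beta>\<^sub>j)\<close> only those of \<open>a\<close>; each
  block consists of the coefficients of Lagrange interpolants of monomials, which are the monomials
  themselves. For the equation \<open>a x + b y = c\<close>, evaluation at the zeros of \<open>b\<close> and of \<open>a\<close> forces
  \<open>x\<close> and \<open>y\<close> to be the interpolants, and conversely \<open>a X + b Y\<close> and \<open>c\<close> have degree below \<open>m + n\<close>
  and agree at \<open>m + n\<close> points.
\<close>

section \<open>Sylvester matrices acting on columns of powers\<close>

lemma sylvester_row_times_powers:
  fixes a b :: "'a :: comm_ring_1 poly"
  assumes p: "p < degree a + degree b"
  shows "(\<Sum>k<degree a + degree b. sylvester_mat a b $$ (p, k) * z ^ (degree a + degree b - 1 - k)) =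
    (if p < degree b then z ^ (degree b - 1 - p) * poly a z
     else z ^ (degree a + degree b - 1 - p) * poly b z)"
proof (cases "p < degree b")
  case True
  \<comment> \<open>Outside columns \<open>p\<close> to \<open>p + degree a\<close>, row
    \<open>p\<close> is zero. The substitution \<open>t = degree a + p - k\<close> then turns the
    column index into the degree of the coefficient of \<open>a\<close>.\<close>
  have "(\<Sum>k<degree a + degree b. sylvester_mat a b $$ (p, k) * z ^ (degree a + degree b - 1 - k)) =
      (\<Sum>k\<in>{p..p + degree a}. coeff a (degree a + p - k) * z ^ (degree a + degree b - 1 - k))"
    using True by (intro sum.mono_neutral_cong_right) (auto simp: sylvester_index_mat)
  also have "\<dots> = (\<Sum>t\<le>degree a. coeff a t * z ^ (degree b - 1 - p + t))"
    using True
    by (intro sum.reindex_bij_witness[where i = "\<lambda>t. degree a + p - t" and j = "\<lambda>k. degree a + p - k"])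
      (auto simp: add.commute[of "degree b"])
  also have "\<dots> = z ^ (degree b - 1 - p) * poly a z"
    by (simp add: poly_altdef sum_distrib_left power_add mult_ac)
  finally show ?thesis using True by simp
next
  case False
  \<comment> \<open>A lower row \<open>p\<close> is the shift of \<open>b\<close> by
    \<open>p - degree b\<close>, so its band ends at column \<open>p\<close>, and
    \<open>p - k\<close> is the degree of the coefficient in column \<open>k\<close>.\<close>
  have "(\<Sum>k<degree a + degree b. sylvester_mat a b $$ (p, k) * z ^ (degree a + degree b - 1 - k)) =
      (\<Sum>k\<in>{p - degree b..p}. coeff b (p - k) * z ^ (degree a + degree b - 1 - k))"
    using False p by (intro sum.mono_neutral_cong_right) (auto simp: sylvester_index_mat)
  also have "\<dots> = (\<Sum>t\<le>degree b. coeff b t * z ^ (degree a + degree b - 1 - p + t))"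
    using False p
    by (intro sum.reindex_bij_witness[where i = "\<lambda>t. p - t" and j = "\<lambda>k. p - k"])
      auto
  also have "\<dots> = z ^ (degree a + degree b - 1 - p) * poly b z"
    by (simp add: poly_altdef sum_distrib_left power_add mult_ac)
  finally show ?thesis using False by simp
qed

lemma det_sylvester_mat_common_root:
  fixes a b :: "'a :: idom poly"
  assumes "degree a + degree b > 0" and roots: "poly a z = 0" "poly b z = 0"
  shows "det (sylvester_mat a b) = 0"
proof -
  let ?N = "degree a + degree b"
  let ?v = "vec ?N (\<lambda>k. z ^ (?N - 1 - k))"
  have "sylvester_mat a b *\<^sub>v ?v = 0\<^sub>v ?N"
  proof (rule eq_vecI)
    fix p assume "p < dim_vec (0\<^sub>v ?N :: 'a vec)"
    then show "(sylvester_mat a b *\<^sub>v ?v) $ p = 0\<^sub>v ?N $ p"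
      using sylvester_row_times_powers[of p a b z]
      by (simp add: scalar_prod_def lessThan_atLeast0 roots)
  qed simp
  \<comment> \<open>The last entry is \<open>z ^ 0 = 1\<close>, so the kernel vector is nonzero even
    for \<open>z = 0\<close>. That entry exists because the sum of the degrees is positive.\<close>
  moreover have "?v \<noteq> 0\<^sub>v ?N"
  proof
    assume "?v = 0\<^sub>v ?N"
    then have "?v $ (?N - 1) = 0\<^sub>v ?N $ (?N - 1)" by (rule arg_cong)
    moreover have "?N - 1 < ?N" using assms(1) by linarith
    ultimately show False by (simp only: index_vec index_zero_vec(1) diff_self_eq_0 power_0 one_neq_zero)
  qed
  ultimately show ?thesis
    using det_0_iff_vec_prod_zero[OF sylvester_carrier_mat] by (metis vec_carrier)
qed

section \<open>Sums in the matrix ring and inverses of matrices\<close>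

lemma index_finsum_mat:
  fixes F :: "'i \<Rightarrow> 'a :: comm_ring_1 mat"
  assumes "finite I" and "\<And>i. i \<in> I \<Longrightarrow> F i \<in> carrier_mat N N" and rc: "r < N" "c < N"
  shows "(\<Oplus>\<^bsub>ring_mat TYPE('a) N b\<^esub>i\<in>I. F i) $$ (r, c) = (\<Sum>i\<in>I. F i $$ (r, c))"
proof -
  interpret ring "ring_mat TYPE('a) N b" by (rule ring_mat)
  show ?thesis
    using assms(1,2)
  proof (induction I rule: finite_induct)
    case empty
    then show ?case using rc by (simp add: ring_mat_simps)
  next
    case (insert i I)
    have "finsum (ring_mat TYPE('a) N b) F I \<in> carrier_mat N N"
      using finsum_closed[of F I] insert.prems by (auto simp: ring_mat_simps)
    with insert show ?case
      using rc by (subst finsum_insert) (auto simp: ring_mat_simps)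
  qed
qed

lemma finsum_mat_carrier:
  fixes F :: "'i \<Rightarrow> 'a :: comm_ring_1 mat"
  assumes "\<And>i. i \<in> I \<Longrightarrow> F i \<in> carrier_mat N N"
  shows "(\<Oplus>\<^bsub>ring_mat TYPE('a) N b\<^esub>i\<in>I. F i) \<in> carrier_mat N N"
proof -
  interpret ring "ring_mat TYPE('a) N b" by (rule ring_mat)
  show ?thesis
    using finsum_closed[of F I] assms by (auto simp: ring_mat_simps)
qed

text \<open>A nonzero determinant makes \<open>A\<close> a unit, so \<open>mat_inverse\<close>
  returns some left inverse \<open>C\<close>, and \<open>C = C * (A * B) = B\<close>. Hence checking
  the product on one side is enough.\<close>

lemma mat_inverse_eq_SomeI:
  fixes A :: "'a :: field mat"
  assumes A: "A \<in> carrier_mat N N" and B: "B \<in> carrier_mat N N"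
    and AB: "A * B = 1\<^sub>m N" and "det A \<noteq> 0"
  shows "mat_inverse A = Some B"
proof -
  have "A \<in> Units (ring_mat TYPE('a) N ())"
    using det_non_zero_imp_unit[OF A \<open>det A \<noteq> 0\<close>] .
  then obtain C where C: "mat_inverse A = Some C"
    using mat_inverse(1)[OF A, of "()"] by (cases "mat_inverse A") auto
  have CA: "C * A = 1\<^sub>m N" and carC: "C \<in> carrier_mat N N"
    using mat_inverse(2)[OF A C] by auto
  have "C = C * (A * B)" using carC AB by simp
  also have "\<dots> = B" using A B carC CA by (simp flip: assoc_mult_mat)
  finally show ?thesis using C by simp
qed

section \<open>Lagrange interpolation through quotients by linear factors\<close>

lemma lagrange_interpolant_unique:
  assumes "finite Z" and "Z \<noteq> {}" and "degree p \<le> card Z - 1"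
    and "\<And>z. z \<in> Z \<Longrightarrow> poly p z = f z"
  shows "p = lagrange_interpolant Z f"
proof (rule poly_eqI_degree[of Z])
  \<comment> \<open>The subtraction in \<open>card Z - 1\<close> is truncated: for empty
    \<open>Z\<close> the degree bound would still admit nonzero constants. With
    \<open>card Z > 0\<close> both degrees lie strictly below the number of points.\<close>
  have "card Z > 0" using assms by (simp add: card_gt_0_iff)
  then show "card Z > degree p" "card Z > degree (lagrange_interpolant Z f)"
    using assms(3) degree_lagrange_interpolant[OF assms(1), of f] by linarith+
qed (use assms poly_lagrange_interpolant in auto)

lemma div_linear_factor:
  fixes u :: "'i \<Rightarrow> 'a :: field"
  assumes "finite I" and "i \<in> I"
  shows "smult c (\<Prod>k\<in>I. [:- u k, 1:]) div [:- u i, 1:] = smult c (\<Prod>k\<in>I - {i}. [:- u k, 1:])"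
proof -
  have "smult c (\<Prod>k\<in>I. [:- u k, 1:]) = smult c (\<Prod>k\<in>I - {i}. [:- u k, 1:]) * [:- u i, 1:]"
    using assms by (subst prod.remove[of I i]) (auto simp: mult_ac)
  then show ?thesis by (metis nonzero_mult_div_cancel_right pCons_eq_0_iff one_neq_zero)
qed

text \<open>The quotient of \<open>p\<close> by its \<open>i\<close>-th linear factor is
  \<open>c\<close> times the product of the other factors. Dividing by its value at
  \<open>u i\<close> cancels \<open>c\<close> and leaves the Lagrange basis polynomial of that
  node.\<close>

lemma sum_quotients_eq_lagrange_interpolant:
  fixes u :: "'i \<Rightarrow> complex"
  assumes I: "finite I" "inj_on u I" and "c \<noteq> 0"
    and p: "p = smult c (\<Prod>k\<in>I. [:- u k, 1:])"
  shows "(\<Sum>i\<in>I. smult (f (u i) / poly (p div [:- u i, 1:]) (u i)) (p div [:- u i, 1:])) =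
    lagrange_interpolant (u ` I) f"
  unfolding lagrange_interpolant_def sum.reindex[OF I(2)] o_def
proof (rule sum.cong[OF refl])
  fix i assume i: "i \<in> I"
  have im: "u ` I - {u i} = u ` (I - {i})" using I(2) i by (auto simp: inj_on_def)
  have inj: "inj_on u (I - {i})" using I(2) by (rule inj_on_subset) auto
  have "(\<Prod>w\<in>u ` I - {u i}. smult (1 / (u i - w)) [:- w, 1:]) =
      smult (1 / (\<Prod>k\<in>I - {i}. u i - u k)) (\<Prod>k\<in>I - {i}. [:- u k, 1:])"
    unfolding im prod.reindex[OF inj] o_def prod_smult by (simp add: prod_dividef)
  then show "smult (f (u i) / poly (p div [:- u i, 1:]) (u i)) (p div [:- u i, 1:]) =
      smult (f (u i)) (\<Prod>w\<in>u ` I - {u i}. smult (1 / (u i - w)) [:- w, 1:])"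
    using \<open>c \<noteq> 0\<close> by (simp add: p div_linear_factor[OF I(1) i] poly_prod)
qed

lemma sum_quotients_eq_poly:
  fixes u :: "'i \<Rightarrow> complex"
  assumes I: "finite I" "I \<noteq> {}" "inj_on u I" and c: "c \<noteq> 0"
    and p: "p = smult c (\<Prod>k\<in>I. [:- u k, 1:])" and q: "degree q \<le> card I - 1"
  shows "(\<Sum>i\<in>I. smult (poly q (u i) / poly (p div [:- u i, 1:]) (u i)) (p div [:- u i, 1:])) = q"
  unfolding sum_quotients_eq_lagrange_interpolant[OF I(1,3) c p, of "poly q"]
  using I q by (intro lagrange_interpolant_unique[symmetric]) (auto simp: card_image)

text \<open>Interpolating the monomial of degree \<open>k\<close> at \<open>card I > k\<close> nodes
  reproduces it; comparing coefficients of degree \<open>l\<close> gives the delta. These sums are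
  the entries of the diagonal blocks in the product of the Sylvester matrix with its
  inverse.\<close>

lemma sum_quotients_coeff_eq_delta:
  fixes u :: "'i \<Rightarrow> complex"
  assumes I: "finite I" "inj_on u I" and c: "c \<noteq> 0"
    and p: "p = smult c (\<Prod>k\<in>I. [:- u k, 1:])" and k: "k < card I"
  shows "(\<Sum>i\<in>I. u i ^ k / poly (p div [:- u i, 1:]) (u i) * coeff (p div [:- u i, 1:]) l) =
    (if k = l then 1 else 0)"
proof -
  have "I \<noteq> {}" using k by auto
  moreover have "degree (monom 1 k :: complex poly) \<le> card I - 1"
    using k by (simp add: degree_monom_eq)
  ultimately have "(\<Sum>i\<in>I. smult (poly (monom 1 k) (u i) / poly (p div [:- u i, 1:]) (u i))
      (p div [:- u i, 1:])) = monom 1 k"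
    using sum_quotients_eq_poly[OF I(1) _ I(2) c p] by blast
  from arg_cong[OF this, of "\<lambda>r. coeff r l"] show ?thesis
    by (simp add: coeff_sum poly_monom coeff_monom)
qed

section \<open>Rank-one summands and their product with the Sylvester matrix\<close>

lemma row_poly_carrier: "row_poly k p \<in> carrier_vec k"
  by (simp add: row_poly_def)

lemma index_Lambda_col_times_row:
  assumes "v \<in> carrier_vec N" "r < N" "q < N"
  shows "(Lambda_col N z * (s \<cdot>\<^sub>m mat_of_row v)) $$ (r, q) = z ^ (N - 1 - r) * (s * v $ q)"
  using assms by (simp add: Lambda_col_def scalar_prod_def mat_of_row_def)

lemma Lambda_col_times_row_carrier:
  assumes "v \<in> carrier_vec N"
  shows "Lambda_col N z * (s \<cdot>\<^sub>m mat_of_row v) \<in> carrier_mat N N"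
  using assms by (auto simp: Lambda_col_def)

lemma index_sylvester_times_rank_one_sum:
  fixes a b :: "complex poly"
  defines "N \<equiv> degree a + degree b"
  assumes I: "finite I" and v: "\<And>i. i \<in> I \<Longrightarrow> v i \<in> carrier_vec N" and pq: "p < N" "q < N"
  shows "(sylvester_mat a b * (\<Oplus>\<^bsub>ring_mat TYPE(complex) N ()\<^esub>i\<in>I.
      Lambda_col N (z i) * (s i \<cdot>\<^sub>m mat_of_row (v i)))) $$ (p, q) =
    (\<Sum>i\<in>I. (if p < degree b then z i ^ (degree b - 1 - p) * poly a (z i)
      else z i ^ (N - 1 - p) * poly b (z i)) * (s i * v i $ q))"
proof -
  let ?S = "sylvester_mat a b"
  let ?M = "\<Oplus>\<^bsub>ring_mat TYPE(complex) N ()\<^esub>i\<in>I. Lambda_col N (z i) * (s i \<cdot>\<^sub>m mat_of_row (v i))"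
  have M: "?M \<in> carrier_mat N N"
    by (intro finsum_mat_carrier Lambda_col_times_row_carrier v)
  have idx: "?M $$ (k, q) = (\<Sum>i\<in>I. z i ^ (N - 1 - k) * (s i * v i $ q))" if "k < N" for k
    using that pq I v
    by (subst index_finsum_mat) (auto simp: Lambda_col_times_row_carrier index_Lambda_col_times_row)
  have "(?S * ?M) $$ (p, q) = (\<Sum>k<N. ?S $$ (p, k) * ?M $$ (k, q))"
    using M pq by (simp add: scalar_prod_def lessThan_atLeast0 N_def)
  also have "\<dots> = (\<Sum>k<N. \<Sum>i\<in>I. ?S $$ (p, k) * z i ^ (N - 1 - k) * (s i * v i $ q))"
    by (simp add: idx sum_distrib_left mult_ac)
  \<comment> \<open>Exchanging the sums isolates a row of the Sylvester matrix times the powers of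
    \<open>z i\<close>, that is, the value at \<open>z i\<close> of a shift of \<open>a\<close> or
    \<open>b\<close>.\<close>
  also have "\<dots> = (\<Sum>i\<in>I. (\<Sum>k<N. ?S $$ (p, k) * z i ^ (N - 1 - k)) * (s i * v i $ q))"
    by (subst sum.swap) (simp add: sum_distrib_right)
  also have "\<dots> = (\<Sum>i\<in>I. (if p < degree b then z i ^ (degree b - 1 - p) * poly a (z i)
      else z i ^ (N - 1 - p) * poly b (z i)) * (s i * v i $ q))"
    using pq(1) unfolding N_def by (subst sylvester_row_times_powers) auto
  finally show ?thesis .
qed

section \<open>The polynomial equation \<open>a * x + b * y = c\<close>\<close>

lemma bezout_interpolation:
  fixes a b c :: "complex poly"
  defines "A \<equiv> {z. poly a z = 0}" and "B \<equiv> {z. poly b z = 0}"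
  assumes deg: "degree a > 0" "degree b > 0" and card: "card A = degree a" "card B = degree b"
    and disj: "A \<inter> B = {}" and c: "degree c \<le> degree a + degree b - 1"
  defines "X \<equiv> lagrange_interpolant B (\<lambda>z. poly c z / poly a z)"
    and "Y \<equiv> lagrange_interpolant A (\<lambda>z. poly c z / poly b z)"
  shows "(degree x \<le> degree b - 1 \<and> degree y \<le> degree a - 1 \<and> a * x + b * y = c) \<longleftrightarrow>
    (x = X \<and> y = Y)"
proof -
  have ne: "a \<noteq> 0" "b \<noteq> 0" using deg by auto
  have fin: "finite A" "finite B" unfolding A_def B_def using ne poly_roots_finite by blast+
  have nonempty: "A \<noteq> {}" "B \<noteq> {}" using card deg by auto
  have a0: "poly a z = 0 \<longleftrightarrow> z \<in> A" and b0: "poly b z = 0 \<longleftrightarrow> z \<in> B" for z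
    by (auto simp: A_def B_def)
  have dX: "degree X \<le> degree b - 1" and dY: "degree Y \<le> degree a - 1"
    unfolding X_def Y_def using degree_lagrange_interpolant fin card by metis+
  have XY: "a * X + b * Y = c"
  proof (rule poly_eqI_degree[of "A \<union> B"])
    fix z assume "z \<in> A \<union> B"
    then consider "z \<in> A" "z \<notin> B" | "z \<in> B" "z \<notin> A" using disj by auto
    \<comment> \<open>At a zero of one polynomial its term vanishes, and the other term equals
      \<open>poly c z\<close> because the interpolated quotient has a nonzero denominator
      there.\<close>
    then show "poly (a * X + b * Y) z = poly c z"
      by cases (auto simp: X_def Y_def poly_lagrange_interpolant fin, (simp add: a0 b0)+)
  next
    have N: "card (A \<union> B) = degree a + degree b"
      using fin disj card by (simp add: card_Un_disjoint)
    then show "card (A \<union> B) > degree c" using c deg by simp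
    have "degree (a * X + b * Y) \<le> degree a + degree b - 1"
      using degree_mult_le[of a X] degree_mult_le[of b Y] dX dY deg
      by (intro degree_add_le) linarith+
    with N show "card (A \<union> B) > degree (a * X + b * Y)" using deg by simp
  qed
  show ?thesis
  proof
    assume "x = X \<and> y = Y"
    then show "degree x \<le> degree b - 1 \<and> degree y \<le> degree a - 1 \<and> a * x + b * y = c"
      using dX dY XY by simp
  next
    assume xy: "degree x \<le> degree b - 1 \<and> degree y \<le> degree a - 1 \<and> a * x + b * y = c"
    have ev: "poly a z * poly x z + poly b z * poly y z = poly c z" for z
      using xy by auto
    \<comment> \<open>At zeros of \<open>b\<close> the equation reads
      \<open>poly a z * poly x z = poly c z\<close>, which prescribes the value of \<open>x\<close>
      at \<open>degree b\<close> points. The argument for \<open>y\<close> exchanges the roles of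
      \<open>a\<close> and \<open>b\<close>.\<close>
    have "x = X" unfolding X_def
    proof (rule lagrange_interpolant_unique[OF fin(2) nonempty(2)])
      fix z assume "z \<in> B"
      then have "poly b z = 0" "poly a z \<noteq> 0" using disj by (auto simp: a0 b0)
      then show "poly x z = poly c z / poly a z"
        using ev[of z] by (simp add: field_simps)
    qed (use xy card in simp)
    moreover have "y = Y" unfolding Y_def
    proof (rule lagrange_interpolant_unique[OF fin(1) nonempty(1)])
      fix z assume "z \<in> A"
      then have "poly a z = 0" "poly b z \<noteq> 0" using disj by (auto simp: a0 b0)
      then show "poly y z = poly c z / poly b z"
        using ev[of z] by (simp add: field_simps)
    qed (use xy card in simp)
    ultimately show "x = X \<and> y = Y" ..
  qed
qed

section \<open>The inverse as a sum over the zeros, and the solution by interpolation\<close>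

theorem corollary1:
  fixes m n :: nat
    and ac bc \<alpha> \<beta> :: "nat \<Rightarrow> complex"
    and a b :: "complex poly"
  assumes "m \<ge> 1" and "n \<ge> 1"
    and "a = (\<Sum>k\<le>m. monom (ac k) (m - k))"
    and "a = smult (ac 0) (\<Prod>i=1..m. [:- \<alpha> i, 1:])"
    and "b = (\<Sum>k\<le>n. monom (bc k) (n - k))"
    and "b = smult (bc 0) (\<Prod>j=1..n. [:- \<beta> j, 1:])"
    and "ac 0 * bc 0 \<noteq> 0"
    and "inj_on \<alpha> {1..m}" and "inj_on \<beta> {1..n}"
    and "det (sylvester_mat a b) \<noteq> 0"
  shows
    "mat_inverse (sylvester_mat a b) = Some (
       (\<Oplus>\<^bsub>ring_mat TYPE(complex) (m + n) ()\<^esub>i\<in>{1..m}.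
          Lambda_col (m + n) (\<alpha> i) *
          ((1 / (poly b (\<alpha> i) * poly (a div [:- \<alpha> i, 1:]) (\<alpha> i))) \<cdot>\<^sub>m
             mat_of_row (0\<^sub>v n @\<^sub>v row_poly m (a div [:- \<alpha> i, 1:])))) +
       (\<Oplus>\<^bsub>ring_mat TYPE(complex) (m + n) ()\<^esub>j\<in>{1..n}.
          Lambda_col (m + n) (\<beta> j) *
          ((1 / (poly a (\<beta> j) * poly (b div [:- \<beta> j, 1:]) (\<beta> j))) \<cdot>\<^sub>m
             mat_of_row (row_poly n (b div [:- \<beta> j, 1:]) @\<^sub>v 0\<^sub>v m))))
     \<and>
     (\<forall>c :: complex poly. degree c \<le> m + n - 1 \<longrightarrow>
       (let X = (\<Sum>j=1..n. smult (1 / poly (b div [:- \<beta> j, 1:]) (\<beta> j) *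
                                  (poly c (\<beta> j) / poly a (\<beta> j)))
                                 (b div [:- \<beta> j, 1:]));
            Y = (\<Sum>i=1..m. smult (1 / poly (a div [:- \<alpha> i, 1:]) (\<alpha> i) *
                                  (poly c (\<alpha> i) / poly b (\<alpha> i)))
                                 (a div [:- \<alpha> i, 1:]))
        in (\<forall>x y :: complex poly.
              (degree x \<le> n - 1 \<and> degree y \<le> m - 1 \<and> a * x + b * y = c) \<longleftrightarrow>
              (x = X \<and> y = Y))
           \<and> X = lagrange_interpolant {z. poly b z = 0} (\<lambda>z. poly c z / poly a z)
           \<and> Y = lagrange_interpolant {z. poly a z = 0} (\<lambda>z. poly c z / poly b z)))"
proof -
  note a_prod = assms(4) and b_prod = assms(6)
  have nz: "ac 0 \<noteq> 0" "bc 0 \<noteq> 0" using assms(7) by auto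
  have deg: "degree a = m" "degree b = n"
    using nz by (simp_all add: a_prod b_prod degree_prod_eq_sum_degree)
  have rootsA: "{z. poly a z = 0} = \<alpha> ` {1..m}" and rootsB: "{z. poly b z = 0} = \<beta> ` {1..n}"
    using nz by (auto simp: a_prod b_prod poly_prod)
  have disj: "poly a z \<noteq> 0 \<or> poly b z \<noteq> 0" for z
    using det_sylvester_mat_common_root[of a b z] assms(1,2,10) deg by auto
  have \<alpha>: "poly a (\<alpha> i) = 0" "poly b (\<alpha> i) \<noteq> 0" if "i \<in> {1..m}" for i
    using rootsA that disj by blast+
  have \<beta>: "poly b (\<beta> j) = 0" "poly a (\<beta> j) \<noteq> 0" if "j \<in> {1..n}" for j
    using rootsB that disj by blast+
  let ?N = "m + n"
  let ?S = "sylvester_mat a b"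
  let ?A = "\<lambda>i. a div [:- \<alpha> i, 1:]" and ?B = "\<lambda>j. b div [:- \<beta> j, 1:]"
  let ?s = "\<lambda>i. 1 / (poly b (\<alpha> i) * poly (?A i) (\<alpha> i))"
  let ?t = "\<lambda>j. 1 / (poly a (\<beta> j) * poly (?B j) (\<beta> j))"
  let ?v = "\<lambda>i. 0\<^sub>v n @\<^sub>v row_poly m (?A i)" and ?w = "\<lambda>j. row_poly n (?B j) @\<^sub>v 0\<^sub>v m"
  let ?MA = "\<Oplus>\<^bsub>ring_mat TYPE(complex) ?N ()\<^esub>i\<in>{1..m}.
    Lambda_col ?N (\<alpha> i) * (?s i \<cdot>\<^sub>m mat_of_row (?v i))"
  let ?MB = "\<Oplus>\<^bsub>ring_mat TYPE(complex) ?N ()\<^esub>j\<in>{1..n}.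
    Lambda_col ?N (\<beta> j) * (?t j \<cdot>\<^sub>m mat_of_row (?w j))"
  have S: "?S \<in> carrier_mat ?N ?N" using sylvester_carrier_mat[of a b] deg by simp
  have v: "?v i \<in> carrier_vec ?N" for i
    using append_carrier_vec[of "0\<^sub>v n" n "row_poly m (?A i)" m]
    by (simp add: row_poly_carrier add.commute)
  have w: "?w j \<in> carrier_vec ?N" for j
    using append_carrier_vec[of "row_poly n (?B j)" n "0\<^sub>v m" m]
    by (simp add: row_poly_carrier add.commute)
  have MA: "?MA \<in> carrier_mat ?N ?N" and MB: "?MB \<in> carrier_mat ?N ?N"
    by (intro finsum_mat_carrier Lambda_col_times_row_carrier v w)+
  have "?S * (?MA + ?MB) = 1\<^sub>m ?N"
  proof (rule eq_matI)
    fix p q assume "p < dim_row (1\<^sub>m ?N :: complex mat)" "q < dim_col (1\<^sub>m ?N :: complex mat)"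
    then have pq: "p < ?N" "q < ?N" by auto
    have SA: "(?S * ?MA) $$ (p, q) =
        (\<Sum>i\<in>{1..m}. (if p < n then \<alpha> i ^ (n - 1 - p) * poly a (\<alpha> i)
          else \<alpha> i ^ (?N - 1 - p) * poly b (\<alpha> i)) * (?s i * ?v i $ q))"
      using index_sylvester_times_rank_one_sum[of "{1..m}" ?v a b p q \<alpha> ?s] pq v
      unfolding deg by simp
    have SB: "(?S * ?MB) $$ (p, q) =
        (\<Sum>j\<in>{1..n}. (if p < n then \<beta> j ^ (n - 1 - p) * poly a (\<beta> j)
          else \<beta> j ^ (?N - 1 - p) * poly b (\<beta> j)) * (?t j * ?w j $ q))"
      using index_sylvester_times_rank_one_sum[of "{1..n}" ?w a b p q \<beta> ?t] pq w
      unfolding deg by simp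
    have A: "(?S * ?MA) $$ (p, q) = (if p = q \<and> n \<le> p then 1 else 0)"
    proof (cases "p < n \<or> q < n")
      case True
      \<comment> \<open>For \<open>p < n\<close> every summand contains
        \<open>poly a (\<alpha> i) = 0\<close>; for \<open>q < n\<close> the entry falls into the
        zero padding of \<open>?v i\<close>.\<close>
      then show ?thesis unfolding SA
        using pq \<alpha> by (auto intro!: sum.neutral simp: row_poly_def)
    next
      case False
      \<comment> \<open>In the lower right block the factor \<open>poly b (\<alpha> i)\<close>
        cancels against \<open>?s i\<close>. Position \<open>q - n\<close> of the row of length
        \<open>m\<close> holds the coefficient of degree
        \<open>m - 1 - (q - n) = ?N - 1 - q\<close>, and \<open>n \<le> p\<close> puts the exponent
        \<open>?N - 1 - p\<close> below \<open>m\<close>.\<close>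
      then have "(?S * ?MA) $$ (p, q) =
          (\<Sum>i\<in>{1..m}. \<alpha> i ^ (?N - 1 - p) / poly (?A i) (\<alpha> i) * coeff (?A i) (?N - 1 - q))"
        unfolding SA using pq \<alpha> by (intro sum.cong) (auto simp: row_poly_def)
      also have "\<dots> = (if ?N - 1 - p = ?N - 1 - q then 1 else 0)"
        using False pq
        by (intro sum_quotients_coeff_eq_delta[OF _ assms(8) nz(1) a_prod]) auto
      finally show ?thesis using False pq by auto
    qed
    have B: "(?S * ?MB) $$ (p, q) = (if p = q \<and> p < n then 1 else 0)"
    proof (cases "n \<le> p \<or> n \<le> q")
      case True
      \<comment> \<open>Now \<open>poly b (\<beta> j) = 0\<close> removes the rows from
        \<open>n\<close> on, and the padding at the end of \<open>?w j\<close> removes the columns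
        from \<open>n\<close> on.\<close>
      then show ?thesis unfolding SB
        using pq \<beta> by (auto intro!: sum.neutral simp: row_poly_def)
    next
      case False
      then have "(?S * ?MB) $$ (p, q) =
          (\<Sum>j\<in>{1..n}. \<beta> j ^ (n - 1 - p) / poly (?B j) (\<beta> j) * coeff (?B j) (n - 1 - q))"
        unfolding SB using pq \<beta> by (intro sum.cong) (auto simp: row_poly_def)
      also have "\<dots> = (if n - 1 - p = n - 1 - q then 1 else 0)"
        using False pq
        by (intro sum_quotients_coeff_eq_delta[OF _ assms(9) nz(2) b_prod]) auto
      finally show ?thesis using False pq by auto
    qed
    have "(?S * (?MA + ?MB)) $$ (p, q) = (?S * ?MA + ?S * ?MB) $$ (p, q)"
      using mult_add_distrib_mat[OF S MA MB] by (rule arg_cong)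
    also have "\<dots> = (?S * ?MA) $$ (p, q) + (?S * ?MB) $$ (p, q)"
      using S MA MB pq by (intro index_add_mat(1)) auto
    \<comment> \<open>The two products are the identity on the last \<open>m\<close> and on the
      first \<open>n\<close> indices respectively, so together they give the full identity.\<close>
    also have "\<dots> = 1\<^sub>m ?N $$ (p, q)"
      unfolding A B using pq by auto
    finally show "(?S * (?MA + ?MB)) $$ (p, q) = 1\<^sub>m ?N $$ (p, q)" .
  qed (use S MA MB in auto)
  then have inverse: "mat_inverse ?S = Some (?MA + ?MB)"
    using S MA MB assms(10) by (intro mat_inverse_eq_SomeI) auto
  let ?X = "\<lambda>c. \<Sum>j=1..n. smult (1 / poly (?B j) (\<beta> j) * (poly c (\<beta> j) / poly a (\<beta> j))) (?B j)"
  let ?Y = "\<lambda>c. \<Sum>i=1..m. smult (1 / poly (?A i) (\<alpha> i) * (poly c (\<alpha> i) / poly b (\<alpha> i))) (?A i)"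
  have X: "?X c = lagrange_interpolant {z. poly b z = 0} (\<lambda>z. poly c z / poly a z)" for c
    using sum_quotients_eq_lagrange_interpolant[OF _ assms(9) nz(2) b_prod, of "\<lambda>z. poly c z / poly a z"]
    unfolding rootsB by (simp add: mult.commute)
  have Y: "?Y c = lagrange_interpolant {z. poly a z = 0} (\<lambda>z. poly c z / poly b z)" for c
    using sum_quotients_eq_lagrange_interpolant[OF _ assms(8) nz(1) a_prod, of "\<lambda>z. poly c z / poly b z"]
    unfolding rootsA by (simp add: mult.commute)
  have card: "card {z. poly a z = 0} = degree a" "card {z. poly b z = 0} = degree b"
    unfolding rootsA rootsB deg using assms(8,9) by (simp_all add: card_image)
  have solution: "(degree x \<le> n - 1 \<and> degree y \<le> m - 1 \<and> a * x + b * y = c) \<longleftrightarrow> (x = ?X c \<and> y = ?Y c)"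
    if "degree c \<le> m + n - 1" for c x y
    unfolding X Y
    using bezout_interpolation[of a b c x y] card disj that assms(1,2) by (auto simp: deg)
  show ?thesis
    unfolding Let_def using inverse solution X Y by (intro conjI allI impI) simp_all
qed

end
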